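(* Let $k\ge 20$ be a fixed integer and let $m=m(n)$ be any sequence of positive integers with $m\le (2^k-1)\binom{n}{k}$ and $$\frac{m}{n}\ \ge\ (1+0.99^k)\,2^k\ln 2 .$$ Then, as $n\to\infty$, all but a $o(1)$-fraction of the satisfiable $k$-CNF formulas $F$ with exactly $m$ clauses over $n$ variables satisfy $$r_{\max}(F)\ \le\ 50\,k\,2^{-k}\,n .$$
   Context: A $k$-clause over $n$ Boolean variables is a disjunction of $k$ literals on $k$ distinct variables; there are $2^k\binom{n}{k}$ such clauses. A $k$-CNF formula with exactly $m$ clauses is a set of $m$ distinct $k$-clauses (understood as their conjunction). A formula is satisfiable if some assignment in $\{\text{TRUE},\text{FALSE}\}^n$ satisfies all its clauses. For a satisfiable formula $F$, $r_{\max}(F)$ denotes the maximal Hamming distance between a pair of satisfying assignments of $F$ (it is $0$ if there is only one satisfying assignment). "All but a $o(1)$-fraction" means that the proportion, among satisfiable $k$-CNF formulas with exactly $m=m(n)$ clauses over $n$ variables, of those violating the inequality tends to $0$ as $n\to\infty$ with $k$ fixed. All logarithms $\ln$ are natural. *)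

theory Defs
  imports Complex_Main "HOL-Library.FuncSet"
begin

text \<open>
  The variables are \<open>{..<n}\<close>. A literal is a pair of a variable and the truth value that the
  variable must take for the literal to hold.
\<close>

type_synonym literal = "nat \<times> bool"
type_synonym clause = "literal set"
type_synonym cnf = "clause set"

definition k_clauses :: "nat \<Rightarrow> nat \<Rightarrow> clause set" where
  "k_clauses k n = {C. C \<subseteq> {..<n} \<times> UNIV \<and> card C = k \<and> inj_on fst C}"

definition k_cnfs :: "nat \<Rightarrow> nat \<Rightarrow> nat \<Rightarrow> cnf set" where
  "k_cnfs k n m = {F. F \<subseteq> k_clauses k n \<and> card F = m}"

text \<open>Assignments are \<open>undefined\<close> outside \<open>{..<n}\<close>, so that there are exactly \<open>2 ^ n\<close> of them.\<close>

definition assignments :: "nat \<Rightarrow> (nat \<Rightarrow> bool) set" where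
  "assignments n = {..<n} \<rightarrow>\<^sub>E UNIV"

definition satisfies :: "(nat \<Rightarrow> bool) \<Rightarrow> cnf \<Rightarrow> bool" where
  "satisfies \<sigma> F \<longleftrightarrow> (\<forall>C\<in>F. \<exists>(x, b)\<in>C. \<sigma> x = b)"

definition solutions :: "nat \<Rightarrow> cnf \<Rightarrow> (nat \<Rightarrow> bool) set" where
  "solutions n F = {\<sigma> \<in> assignments n. satisfies \<sigma> F}"

definition satisfiable :: "nat \<Rightarrow> cnf \<Rightarrow> bool" where
  "satisfiable n F \<longleftrightarrow> (\<exists>\<sigma>\<in>assignments n. satisfies \<sigma> F)"

definition hamming :: "nat \<Rightarrow> (nat \<Rightarrow> bool) \<Rightarrow> (nat \<Rightarrow> bool) \<Rightarrow> nat" where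
  "hamming n \<sigma> \<tau> = card {x \<in> {..<n}. \<sigma> x \<noteq> \<tau> x}"

text \<open>Meaningful only for satisfiable formulas, where the set is nonempty.\<close>

definition r_max :: "nat \<Rightarrow> cnf \<Rightarrow> nat" where
  "r_max n F = Max {hamming n \<sigma> \<tau> | \<sigma> \<tau>. \<sigma> \<in> solutions n F \<and> \<tau> \<in> solutions n F}"

definition sat_k_cnfs :: "nat \<Rightarrow> nat \<Rightarrow> nat \<Rightarrow> cnf set" where
  "sat_k_cnfs k n m = {F \<in> k_cnfs k n m. satisfiable n F}"

lemma card_k_clauses: "card (k_clauses k n) = 2 ^ k * (n choose k)"
proof -
  let ?P = "{A. A \<subseteq> {..<n} \<and> card A = k}"
  let ?S = "SIGMA A:?P. A \<rightarrow>\<^sub>E (UNIV :: bool set)"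
  let ?f = "\<lambda>(A, s). (\<lambda>x. (x, s x)) ` A"
  have "bij_betw ?f ?S (k_clauses k n)"
    unfolding bij_betw_def
  proof
    show "inj_on ?f ?S"
    proof (rule inj_onI, clarsimp)
      fix A s B t
      assume s: "s \<in> A \<rightarrow>\<^sub>E (UNIV :: bool set)" and t: "t \<in> B \<rightarrow>\<^sub>E (UNIV :: bool set)"
        and eq: "(\<lambda>x. (x, s x)) ` A = (\<lambda>x. (x, t x)) ` B"
      have "A = B" using arg_cong[OF eq, of "image fst"] by (simp add: image_image)
      moreover have "s = t"
      proof
        fix x show "s x = t x"
        proof (cases "x \<in> A")
          case True
          then have "(x, s x) \<in> (\<lambda>x. (x, t x)) ` B" unfolding eq[symmetric] by (rule imageI)
          then show ?thesis by (elim imageE) simp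
        next
          case False
          then show ?thesis using PiE_arb[OF s] PiE_arb[OF t] \<open>A = B\<close> by simp
        qed
      qed
      ultimately show "A = B \<and> s = t" by simp
    qed
    show "?f ` ?S = k_clauses k n"
    proof
      show "?f ` ?S \<subseteq> k_clauses k n"
        by (auto simp: k_clauses_def inj_on_def card_image)
      show "k_clauses k n \<subseteq> ?f ` ?S"
      proof
        fix C assume C: "C \<in> k_clauses k n"
        define A where "A = fst ` C"
        define s where "s = restrict (\<lambda>x. (x, True) \<in> C) A"
        have inj: "inj_on fst C" using C by (simp add: k_clauses_def)
        have "A \<subseteq> {..<n}" "card A = k"
          using C by (auto simp: k_clauses_def A_def card_image)
        moreover have "C = (\<lambda>x. (x, s x)) ` A"
        proof -
          have s: "s (fst l) = snd l" if "l \<in> C" for l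
          proof -
            have "fst l \<in> A" using that by (simp add: A_def)
            moreover have "(fst l, True) \<in> C \<longleftrightarrow> snd l"
              using inj_onD[OF inj _ _ that, of "(fst l, True)"] that by (cases l) auto
            ultimately show ?thesis by (simp add: s_def)
          qed
          have "(\<lambda>x. (x, s x)) ` A = (\<lambda>l. (fst l, s (fst l))) ` C"
            by (simp add: A_def image_image)
          also have "\<dots> = (\<lambda>l. l) ` C" by (intro image_cong refl) (simp add: s)
          finally show ?thesis by simp
        qed
        moreover have "s \<in> A \<rightarrow>\<^sub>E UNIV" by (simp add: s_def)
        ultimately show "C \<in> ?f ` ?S" by (auto intro!: image_eqI[of _ _ "(A, s)"])
      qed
    qed
  qed
  then have "card (k_clauses k n) = card ?S" by (simp add: bij_betw_same_card)
  also have "\<dots> = (\<Sum>A\<in>?P. card (A \<rightarrow>\<^sub>E (UNIV :: bool set)))"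
    by (intro card_SigmaI) (auto intro!: finite_PiE dest: finite_subset[of _ "{..<n}"])
  also have "\<dots> = (\<Sum>A\<in>?P. 2 ^ k)"
    by (intro sum.cong refl) (auto simp: card_PiE dest: finite_subset[of _ "{..<n}"])
  also have "\<dots> = 2 ^ k * (n choose k)"
    by (simp add: n_subsets)
  finally show ?thesis .
qed

end

theory Submission
  imports Defs "HOL-Analysis.Analysis" "HOL-Real_Asymp.Real_Asymp"
begin

text \<open>
  The proof is a first and second moment argument. All assignments have the same number \<open>c\<close> of
  formulas that they satisfy. Given that a formula is satisfied by \<open>\<sigma>\<close>, the expected number of its
  solutions at distance \<open>d\<close> from \<open>\<sigma>\<close> is at most \<open>(n choose d) * pair_weight k n d\<close>
  (\<open>card_satisfied_by_both_le\<close>), where the weight is roughly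
  \<open>2 ^ (- n (1 + 0.99 ^ k) (1 - (1 - d / n) ^ k))\<close>.

  At this density a random formula is typically unsatisfiable, so the number of satisfiable formulas
  has to be bounded below. Counting pairs of a formula and a solution counts a formula once for each
  of its solutions; Cauchy--Schwarz shows that the loss is at most the expected number \<open>A\<close> of solutions
  of a formula with a planted solution. The formulas with two solutions at distance more than
  \<open>50 k n / 2 ^ k\<close> are at most as many as the triples of a formula and two such solutions. If \<open>B\<close>
  bounds the expected number of solutions that far from a planted one, the fraction in question is
  at most \<open>A * B\<close> (\<open>second_moment_bound\<close>). Both are sums over the \<open>n + 1\<close> possible distances.

  Everything now depends on the exponent of \<open>(n choose d) * pair_weight k n d\<close>. For \<open>d\<close> of order
  \<open>n / 2 ^ k\<close> entropy and weight nearly cancel, and the product is at most \<open>exp (n / 2 ^ k)\<close>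
  (\<open>binomial_times_weight_le\<close>). For \<open>d \<ge> 50 k n / 2 ^ k\<close> the weight wins, and the product is at
  most \<open>exp (- 2 n / 2 ^ k)\<close> (\<open>binomial_times_weight_le_far\<close>). Therefore \<open>A * B\<close> is at most
  \<open>(n + 1) ^ 2 * exp (- n / 2 ^ k)\<close>, which tends to \<open>0\<close>. The weight belongs to
  the least density considered, since additional clauses only decrease the conditional probability.
\<close>

section \<open>Elementary inequalities\<close>

text \<open>
  Bernoulli's inequality gives \<open>1 + k y \<le> (1 + y) ^ k\<close>, and \<open>(1 - y) (1 + y) \<le> 1\<close>. The resulting
  bound is sharp enough at both scales that matter below: it is about \<open>k y\<close> for small \<open>k y\<close>, and at
  least \<open>1 / 2\<close> once \<open>k y \<ge> 1\<close>.
\<close>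

lemma one_minus_power_le:
  fixes y :: real
  assumes "0 \<le> y" "y \<le> 1"
  shows "real k * y / (1 + real k * y) \<le> 1 - (1 - y) ^ k"
proof -
  have "(1 - y) ^ k * (1 + real k * y) \<le> (1 - y) ^ k * (1 + y) ^ k"
    using assms by (intro mult_left_mono Bernoulli_inequality) auto
  also have "\<dots> = (1 - y\<^sup>2) ^ k"
    by (simp add: power_mult_distrib [symmetric] power2_eq_square algebra_simps)
  also have "\<dots> \<le> 1"
    using assms by (intro power_le_one) (auto simp: power2_eq_square mult_le_one)
  finally have "(1 - y) ^ k * (1 + real k * y) \<le> 1" .
  moreover have "1 + real k * y > 0"
    using assms by (simp add: add_pos_nonneg)
  ultimately show ?thesis
    by (simp add: field_simps)
qed

text \<open>
  One term of the binomial expansion of \<open>(1 + x) ^ n \<le> exp (n x)\<close>. The free parameter \<open>x\<close> takes the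
  place of the entropy function: choosing it near \<open>d / n\<close> gives the usual entropy bound, but coarser
  choices make the estimates below linear in the exponent.
\<close>

lemma binomial_le_exp_over_power:
  fixes x :: real
  assumes "0 < x"
  shows "real (n choose d) \<le> exp (real n * x) / x ^ d"
proof (cases "d \<le> n")
  case True
  have "real (n choose d) * x ^ d \<le> (\<Sum>j\<le>n. real (n choose j) * x ^ j)"
    using True assms by (intro member_le_sum [where f = "\<lambda>j. real (n choose j) * x ^ j"]) auto
  also have "\<dots> = (x + 1) ^ n"
    by (simp add: binomial_ring)
  also have "\<dots> \<le> exp x ^ n"
    using assms exp_ge_add_one_self [of x] by (intro power_mono) (auto simp: add.commute)
  also have "\<dots> = exp (real n * x)"
    by (simp add: exp_of_nat_mult)
  finally show ?thesis
    using assms by (simp add: field_simps)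
next
  case False
  then show ?thesis
    using assms by (simp add: binomial_eq_0)
qed

text \<open>
  Each factor \<open>(a - i) / (b - i)\<close> of the ratio of falling factorials is at most \<open>a / b\<close>. This serves
  twice: for formulas (\<open>m\<close> clauses drawn without replacement) and for clauses (\<open>k\<close> variables drawn
  without replacement).
\<close>

lemma binomial_ratio_le:
  assumes "a \<le> b" "0 < b"
  shows "real (a choose m) \<le> real (b choose m) * (real a / real b) ^ m"
proof (cases "m \<le> a")
  case True
  have "real (a choose m) = (\<Prod>i = 0..<m. real (a - i) / real (m - i))"
    using True by (simp add: binomial_altdef_of_nat)
  also have "\<dots> \<le> (\<Prod>i = 0..<m. real (b - i) / real (m - i) * (real a / real b))"
  proof (intro prod_mono conjI)
    fix i assume i: "i \<in> {0..<m}"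
    have "real (a - i) * real b \<le> real (b - i) * real a"
      using i True assms mult_right_mono [of "real a" "real b" "real i"]
      by (simp add: of_nat_diff algebra_simps)
    then have "real (a - i) \<le> real (b - i) * (real a / real b)"
      using assms by (simp add: field_simps)
    then show "real (a - i) / real (m - i) \<le> real (b - i) / real (m - i) * (real a / real b)"
      using divide_right_mono [of "real (a - i)" "real (b - i) * (real a / real b)" "real (m - i)"]
      by (simp add: mult_ac)
  qed auto
  also have "\<dots> = (\<Prod>i = 0..<m. real (b - i) / real (m - i)) * (real a / real b) ^ m"
    by (simp only: prod.distrib prod_constant card_atLeastLessThan diff_zero)
  also have "(\<Prod>i = 0..<m. real (b - i) / real (m - i)) = real (b choose m)"
    using True assms by (subst binomial_altdef_of_nat) auto
  finally show ?thesis .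
qed (simp add: binomial_eq_0)

lemma squares_le_power:
  assumes "k \<ge> 20" shows "50 * real k ^ 2 \<le> 1.98 ^ k"
  using assms
proof (induction k rule: nat_induct_at_least)
  case base show ?case by (simp add: power_divide)
next
  case (Suc k)
  have "50 * real (Suc k) ^ 2 \<le> 1.98 * (50 * real k ^ 2)"
  proof -
    have "20 * real k \<le> real k * real k"
      using Suc.hyps by (intro mult_right_mono) auto
    moreover have "20 \<le> real k" using Suc.hyps by simp
    ultimately have "50 + real k * 100 \<le> real k * real k * 49" by linarith
    then show ?thesis by (simp add: power2_eq_square algebra_simps)
  qed
  then show ?case using Suc.IH by simp
qed

lemma linear_le_power:
  assumes "k \<ge> 20" shows "9 * real k \<le> 1.4 ^ k"
  using assms
proof (induction k rule: nat_induct_at_least)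
  case base show ?case by (simp add: power_divide)
next
  case (Suc k)
  have "9 * real (Suc k) \<le> 1.4 * (9 * real k)" using Suc.hyps by simp
  then show ?case using Suc.IH by simp
qed

section \<open>Second moment bound for a relation\<close>

lemma card_filter_eq_sum:
  "finite U \<Longrightarrow> real (card {y \<in> U. Q y}) = (\<Sum>y\<in>U. of_bool (Q y))"
  by (simp add: Int_def)

text \<open>
  Read \<open>X\<close> as formulas and \<open>Y\<close> as assignments. Let \<open>s x\<close> be the number of \<open>y\<close> related to \<open>x\<close>. The
  number \<open>P\<close> of related pairs is the sum of \<open>s\<close> over its support \<open>S\<close>, so Cauchy--Schwarz gives
  \<open>P ^ 2 \<le> card S * (\<Sum>x. s x ^ 2)\<close>; the sum of squares counts triples and is at most \<open>P * A\<close>. Hence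
  \<open>P \<le> A * card S\<close>, whereas the union bound over far triples counts at most \<open>P * B\<close> elements.
\<close>

lemma second_moment_bound:
  fixes R :: "'a \<Rightarrow> 'b \<Rightarrow> bool" and A B c :: real
  assumes fin: "finite X" "finite Y"
    and degree: "\<And>y. y \<in> Y \<Longrightarrow> real (card {x \<in> X. R x y}) = c" and "0 < c" "0 \<le> B" "0 \<le> A"
    and all: "\<And>y. y \<in> Y \<Longrightarrow> (\<Sum>z\<in>Y. real (card {x \<in> X. R x y \<and> R x z})) \<le> c * A"
    and far: "\<And>y. y \<in> Y \<Longrightarrow>
      (\<Sum>z\<in>{z \<in> Y. far y z}. real (card {x \<in> X. R x y \<and> R x z})) \<le> c * B"
  shows "real (card {x \<in> X. \<exists>y\<in>Y. \<exists>z\<in>Y. R x y \<and> R x z \<and> far y z})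
    \<le> A * B * real (card {x \<in> X. \<exists>y\<in>Y. R x y})"
proof -
  define S where "S = {x \<in> X. \<exists>y\<in>Y. R x y}"
  define s where "s x = real (card {y \<in> Y. R x y})" for x
  define P where "P = real (card Y) * c"
  have "finite S" using fin by (simp add: S_def)
  have s: "s x = (\<Sum>y\<in>Y. of_bool (R x y))" for x
    unfolding s_def using fin by (intro card_filter_eq_sum)
  have sS: "(\<Sum>x\<in>S. f (s x)) = (\<Sum>x\<in>X. f (s x))" if "f 0 = 0" for f :: "real \<Rightarrow> real"
  proof (intro sum.mono_neutral_left ballI)
    fix x assume "x \<in> X - S"
    then have "{y \<in> Y. R x y} = {}" by (auto simp: S_def)
    then have "s x = 0" unfolding s_def by (simp only: card.empty of_nat_0)
    then show "f (s x) = 0" using that by simp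
  qed (use fin in \<open>auto simp: S_def\<close>)
  have "P = (\<Sum>y\<in>Y. \<Sum>x\<in>X. of_bool (R x y))"
    unfolding P_def
    by (simp only: card_filter_eq_sum [OF fin(1), symmetric] degree sum_constant cong: sum.cong)
  also have "\<dots> = (\<Sum>x\<in>X. s x)"
    unfolding s by (rule sum.swap)
  finally have P: "P = (\<Sum>x\<in>S. s x)" using sS [of "\<lambda>t. t"] by (simp only:)
  have "(\<Sum>x\<in>S. (s x)\<^sup>2) = (\<Sum>x\<in>X. \<Sum>y\<in>Y. \<Sum>z\<in>Y. of_bool (R x y) * of_bool (R x z))"
    using sS [of "\<lambda>t. t\<^sup>2"] by (simp only: s power2_eq_square sum_product mult_zero_left simp_thms)
  also have "\<dots> = (\<Sum>y\<in>Y. \<Sum>z\<in>Y. \<Sum>x\<in>X. of_bool (R x y \<and> R x z))"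
    by (subst sum.swap, intro sum.cong refl, subst sum.swap) (simp only: of_bool_conj)
  also have "\<dots> = (\<Sum>y\<in>Y. \<Sum>z\<in>Y. real (card {x \<in> X. R x y \<and> R x z}))"
    using fin by (simp only: card_filter_eq_sum)
  also have "\<dots> \<le> (\<Sum>y\<in>Y. c * A)"
    by (intro sum_mono all)
  also have "\<dots> = P * A"
    by (simp add: P_def)
  finally have sq: "(\<Sum>x\<in>S. (s x)\<^sup>2) \<le> P * A" .
  have "P * P \<le> (\<Sum>x\<in>S. (s x)\<^sup>2) * real (card S)"
    using sum_squared_le_sum_of_squares [of s S] \<open>finite S\<close> by (simp add: P power2_eq_square)
  also have "\<dots> \<le> P * A * real (card S)"
    using sq by (intro mult_right_mono) auto
  finally have PP: "P * P \<le> P * (A * real (card S))" by (simp add: mult_ac)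
  have "P \<ge> 0" using assms by (simp add: P_def)
  have PS: "P \<le> A * real (card S)"
    using PP \<open>P \<ge> 0\<close> \<open>0 \<le> A\<close> by (cases "P = 0") auto
  have "{x \<in> X. \<exists>y\<in>Y. \<exists>z\<in>Y. R x y \<and> R x z \<and> far y z}
      \<subseteq> (\<Union>y\<in>Y. \<Union>z\<in>{z \<in> Y. far y z}. {x \<in> X. R x y \<and> R x z})"
    by blast
  then have "card {x \<in> X. \<exists>y\<in>Y. \<exists>z\<in>Y. R x y \<and> R x z \<and> far y z}
      \<le> card (\<Union>y\<in>Y. \<Union>z\<in>{z \<in> Y. far y z}. {x \<in> X. R x y \<and> R x z})"
    using fin by (intro card_mono) auto
  also have "\<dots> \<le> (\<Sum>y\<in>Y. card (\<Union>z\<in>{z \<in> Y. far y z}. {x \<in> X. R x y \<and> R x z}))"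
    using fin by (intro card_UN_le)
  also have "\<dots> \<le> (\<Sum>y\<in>Y. \<Sum>z\<in>{z \<in> Y. far y z}. card {x \<in> X. R x y \<and> R x z})"
    using fin by (intro sum_mono card_UN_le) auto
  finally have "real (card {x \<in> X. \<exists>y\<in>Y. \<exists>z\<in>Y. R x y \<and> R x z \<and> far y z})
      \<le> (\<Sum>y\<in>Y. \<Sum>z\<in>{z \<in> Y. far y z}. real (card {x \<in> X. R x y \<and> R x z}))"
    by (simp only: of_nat_sum [symmetric] of_nat_le_iff)
  also have "\<dots> \<le> (\<Sum>y\<in>Y. c * B)"
    by (intro sum_mono far)
  also have "\<dots> = P * B" by (simp add: P_def)
  also have "\<dots> \<le> A * real (card S) * B"
    using PS \<open>0 \<le> B\<close> by (rule mult_right_mono)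
  finally show ?thesis by (simp add: S_def mult_ac)
qed


section \<open>Expected number of solutions at a given distance\<close>

text \<open>
  An upper bound for the conditional probability that a formula with \<open>m\<close> clauses, satisfied by a given
  assignment, is also satisfied by another one at distance \<open>d\<close>. It is \<open>exp (- m z / 2 ^ k)\<close> with
  \<open>z = 1 - (1 - d / n) ^ k\<close>, evaluated at the least \<open>m\<close> that the density hypothesis permits.
\<close>

definition pair_weight :: "nat \<Rightarrow> nat \<Rightarrow> nat \<Rightarrow> real" where
  "pair_weight k n d =
    exp (- (real n * (1 + 0.99 ^ k) * ln 2 * (1 - (1 - real d / real n) ^ k)))"

lemma pair_weight_le:
  assumes "c \<le> (1 + 0.99 ^ k) * (1 - (1 - real d / real n) ^ k)"
  shows "pair_weight k n d \<le> exp (- (real n * c * ln 2))"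
proof -
  have "(real n * ln 2) * c \<le> (real n * ln 2) * ((1 + 0.99 ^ k) * (1 - (1 - real d / real n) ^ k))"
    using assms by (intro mult_left_mono) auto
  then show ?thesis
    by (simp add: pair_weight_def mult_ac)
qed

text \<open>
  With \<open>y = d / n\<close>, the excess factor \<open>1 + 0.99 ^ k\<close> of the density absorbs the denominator \<open>1 + k y\<close> in
  \<open>one_minus_power_le\<close> as long as \<open>k y \<le> 0.99 ^ k\<close>. What remains is exactly the power of two that
  \<open>binomial_le_exp_over_power\<close> produces with \<open>x\<close> of order \<open>2 ^ (- k)\<close>.
\<close>

lemma pair_weight_le_close:
  assumes "0 < n" "d \<le> n" "real k * real d \<le> 0.99 ^ k * real n"
  shows "pair_weight k n d \<le> 1 / 2 ^ (k * d)"
proof -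
  define y where "y = real d / real n"
  have y: "0 \<le> y" "y \<le> 1" "real k * y \<le> 0.99 ^ k"
    using assms by (auto simp: y_def field_simps)
  have pos: "1 + real k * y > 0"
    using y by (simp add: add_pos_nonneg)
  have "real k * y = (1 + real k * y) * (real k * y / (1 + real k * y))"
    using pos by simp
  also have "\<dots> \<le> (1 + 0.99 ^ k) * (1 - (1 - y) ^ k)"
    using y pos by (intro mult_mono one_minus_power_le) auto
  finally have "pair_weight k n d \<le> exp (- (real n * (real k * y) * ln 2))"
    unfolding y_def by (rule pair_weight_le)
  also have "real n * (real k * y) * ln 2 = real (k * d) * ln 2"
    using assms by (simp add: y_def)
  also have "exp (- (real (k * d) * ln 2)) = 1 / 2 ^ (k * d)"
    by (simp only: exp_minus exp_of_nat_mult) (simp add: field_simps)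
  finally show ?thesis .
qed

lemma power_099_ge:
  assumes "k \<ge> 20"
  shows "50 * real k ^ 2 / 2 ^ k \<le> 0.99 ^ k" "20000 / 2 ^ k \<le> (0.99 :: real) ^ k"
proof -
  have "(1.98 :: real) ^ k = 0.99 ^ k * 2 ^ k"
    by (simp add: power_mult_distrib [symmetric])
  then show *: "50 * real k ^ 2 / 2 ^ k \<le> 0.99 ^ k"
    using squares_le_power [OF assms] by (simp add: field_simps)
  have "20 * 20 \<le> real k ^ 2"
    unfolding power2_eq_square using assms by (intro mult_mono) auto
  then have "20000 / 2 ^ k \<le> 50 * real k ^ 2 / 2 ^ k"
    by (intro divide_right_mono) auto
  with * show "20000 / 2 ^ k \<le> (0.99 :: real) ^ k"
    by linarith
qed

text \<open>
  The expected number of solutions at distance \<open>d\<close> from a planted one decays exponentially once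
  \<open>d \<ge> 50 k n / 2 ^ k\<close>. With \<open>y = d / n\<close> there are four ranges, distinguished by what keeps the
  binomial coefficient below the reciprocal weight. For \<open>k y \<le> 0.99 ^ k\<close> the weight is at most
  \<open>2 ^ (- k d)\<close>, and \<open>x = 2 / 2 ^ k\<close> gains a further factor \<open>2 ^ (- d)\<close>. For \<open>k y \<le> 1\<close> the weight is
  at most \<open>2 ^ (- k d / 2)\<close>, which beats \<open>(k / 0.99 ^ k) ^ d\<close>. For \<open>1 / k \<le> y \<le> 1 / 20\<close> the weight is
  at most \<open>2 ^ (- n / 2)\<close>, which beats the entropy. For \<open>y \<ge> 1 / 20\<close> the trivial bound \<open>2 ^ n\<close> on the
  binomial coefficient suffices, because then \<open>(1 - y) ^ k\<close> is smaller than the excess \<open>0.99 ^ k\<close> by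
  a constant factor.
\<close>

lemma binomial_times_weight_le_far:
  assumes k: "k \<ge> 20" and n: "0 < n" and d: "d \<le> n" and far: "real d \<ge> 50 * real k / 2 ^ k * real n"
  shows "real (n choose d) * pair_weight k n d \<le> exp (- (2 * real n / 2 ^ k))"
proof -
  define u where "u = 1 / (2 :: real) ^ k"
  define e where "e = (0.99 :: real) ^ k"
  define y where "y = real d / real n"
  have u: "u > 0" and e: "e > 0" by (simp_all add: u_def e_def)
  have ln2: "2 / 3 \<le> ln (2 :: real)" by (rule ln2_ge_two_thirds)
  have y: "0 \<le> y" "y \<le> 1" and d_eq: "real d = y * real n"
    using n d by (auto simp: y_def)
  have du: "real d \<ge> 1000 * (u * real n)"
  proof -
    have "1000 * (u * real n) \<le> (50 * real k) * (u * real n)"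
      using k u by (intro mult_right_mono) auto
    then show ?thesis using far by (simp add: u_def)
  qed
  have eu: "20000 * u \<le> e"
    using power_099_ge(2) [OF k] by (simp add: u_def e_def)
  have un: "u * real n > 0" using u n by simp
  have pos: "1 + real k * y > 0"
    using y by (simp add: add_pos_nonneg)
  have wt: "pair_weight k n d \<le> exp (- (real n * c * ln 2))"
    if "c \<le> real k * y / (1 + real k * y)" for c
  proof (rule pair_weight_le)
    have "c \<le> 1 * (1 - (1 - y) ^ k)"
      using that one_minus_power_le [OF y, of k] by simp
    also have "\<dots> \<le> (1 + 0.99 ^ k) * (1 - (1 - y) ^ k)"
      using y by (intro mult_right_mono) (auto simp: power_le_one)
    finally show "c \<le> (1 + 0.99 ^ k) * (1 - (1 - real d / real n) ^ k)"
      by (simp add: y_def)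
  qed
  consider (close) "real k * real d \<le> e * real n"
    | (middle) "e * real n \<le> real k * real d" "real k * y \<le> 1"
    | (moderate) "1 \<le> real k * y" "y \<le> 1 / 20"
    | (large) "1 / 20 \<le> y"
    by linarith
  then have "real (n choose d) * pair_weight k n d \<le> exp (- (2 * (u * real n)))"
  proof cases
    case close
    have "pair_weight k n d \<le> 1 / 2 ^ (k * d)"
      using close unfolding e_def by (rule pair_weight_le_close [OF n d])
    then have "real (n choose d) * pair_weight k n d
        \<le> exp (real n * (2 * u)) / (2 * u) ^ d * (1 / 2 ^ (k * d))"
      using u by (intro mult_mono binomial_le_exp_over_power) (auto simp: pair_weight_def)
    also have "\<dots> = exp (real n * (2 * u)) * exp (- (real d * ln 2))"
      by (simp add: u_def exp_minus exp_of_nat_mult power_mult power_mult_distrib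
          power_divide field_simps) (simp only: power_mult [symmetric] mult.commute)
    also have "\<dots> = exp (2 * (u * real n) - real d * ln 2)"
      by (simp add: exp_add [symmetric] mult_ac)
    also have "\<dots> \<le> exp (- (2 * (u * real n)))"
    proof -
      have "real d * (2 / 3) \<le> real d * ln 2"
        using ln2 by (intro mult_left_mono) auto
      then have "4 * (u * real n) \<le> real d * ln 2"
        using du un by linarith
      then show ?thesis by simp
    qed
    finally show ?thesis .
  next
    case middle
    have "real k > 0" using k by simp
    have sqrt2: "exp (ln 2 / 2) = sqrt 2"
      by (simp add: ln_sqrt [symmetric])
    \<comment> \<open>The product of the bounds for binomial coefficient and weight is \<open>q ^ d\<close>.\<close>
    define q where "q = exp 1 * (real k / e) * exp (- (real k * (ln 2 / 2)))"
    have "real (n choose d) \<le> exp (real n * (e / real k)) / (e / real k) ^ d"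
      using e \<open>real k > 0\<close> by (intro binomial_le_exp_over_power) auto
    also have "\<dots> \<le> exp (real d) / (e / real k) ^ d"
      using middle(1) e \<open>real k > 0\<close> by (intro divide_right_mono) (auto simp: field_simps)
    also have "\<dots> = exp 1 ^ d * (real k / e) ^ d"
      by (simp add: power_divide exp_of_nat_mult [symmetric])
    finally have binom: "real (n choose d) \<le> exp 1 ^ d * (real k / e) ^ d" .
    have "pair_weight k n d \<le> exp (- (real n * (real k * y / 2) * ln 2))"
      using middle(2) y pos by (intro wt divide_left_mono) auto
    also have "real n * (real k * y / 2) * ln 2 = real d * (real k * (ln 2 / 2))"
      by (simp add: d_eq)
    also have "exp (- (real d * (real k * (ln 2 / 2)))) = exp (- (real k * (ln 2 / 2))) ^ d"
      by (simp add: exp_of_nat_mult [symmetric])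
    finally have weight: "pair_weight k n d \<le> exp (- (real k * (ln 2 / 2))) ^ d" .
    have "real (n choose d) * pair_weight k n d \<le> q ^ d"
      unfolding q_def power_mult_distrib using binom weight e
      by (intro mult_mono) (auto simp: pair_weight_def)
    also have "\<dots> \<le> exp (- 1) ^ d"
    proof (rule power_mono)
      have "exp (2 :: real) = exp 1 * exp 1"
        by (simp add: exp_add [symmetric])
      also have "\<dots> \<le> 3 * 3"
        using exp_le by (intro mult_mono) auto
      finally have "exp 2 * real k \<le> 9 * real k"
        by (intro mult_right_mono) auto
      also have "\<dots> \<le> 1.4 ^ k"
        by (rule linear_le_power [OF k])
      also have "\<dots> \<le> (0.99 * sqrt 2) ^ k"
      proof (rule power_mono)
        have "1.4 / 0.99 \<le> sqrt 2"
          by (rule real_le_rsqrt) (simp add: power2_eq_square)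
        then show "1.4 \<le> 0.99 * sqrt 2" by simp
      qed auto
      also have "\<dots> = e * exp (real k * (ln 2 / 2))"
        by (simp only: e_def power_mult_distrib exp_of_nat_mult sqrt2)
      finally have "exp 2 * real k \<le> e * exp (real k * (ln 2 / 2))" .
      then show "q \<le> exp (- 1)"
        using e by (simp add: q_def exp_minus field_simps flip: exp_add)
      show "0 \<le> q" using e by (simp add: q_def)
    qed
    also have "\<dots> = exp (- real d)"
      by (simp add: exp_of_nat_mult [symmetric])
    also have "\<dots> \<le> exp (- (2 * (u * real n)))"
      using du un by simp
    finally show ?thesis .
  next
    case moderate
    have ln20: "ln (20 :: real) \<le> 4"
    proof -
      have "(20 :: real) \<le> 2.5 ^ 4" by (simp add: power_divide)
      also have "\<dots> \<le> exp 1 ^ 4"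
        using exp_lower_Taylor_quadratic [of 1] by (intro power_mono) auto
      also have "\<dots> = exp 4"
        by (simp add: exp_of_nat_mult [symmetric])
      finally have "ln (20 :: real) \<le> ln (exp 4)"
        by (subst ln_le_cancel_iff) auto
      then show ?thesis by simp
    qed
    have "real (n choose d) \<le> exp (real n * (1 / 20)) / (1 / 20) ^ d"
      by (rule binomial_le_exp_over_power) simp
    also have "\<dots> = exp (real n / 20) * exp (real d * ln 20)"
      by (simp add: exp_of_nat_mult power_divide)
    also have "\<dots> = exp (real n / 20 + real d * ln 20)"
      by (simp add: exp_add)
    also have "\<dots> \<le> exp (real n / 4)"
    proof -
      have "real d * ln 20 \<le> (real n / 20) * 4"
        using moderate(2) ln20 n by (intro mult_mono) (auto simp: y_def field_simps)
      then show ?thesis by simp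
    qed
    finally have binom: "real (n choose d) \<le> exp (real n / 4)" .
    have "pair_weight k n d \<le> exp (- (real n * (1 / 2) * ln 2))"
      using moderate(1) pos by (intro wt) (simp add: field_simps)
    also have "\<dots> \<le> exp (- (real n / 3))"
    proof -
      have "(real n / 2) * (2 / 3) \<le> (real n / 2) * ln 2"
        using ln2 by (intro mult_left_mono) auto
      then show ?thesis by simp
    qed
    finally have "real (n choose d) * pair_weight k n d \<le> exp (real n / 4) * exp (- (real n / 3))"
      using binom by (intro mult_mono) (auto simp: pair_weight_def)
    also have "\<dots> = exp (- (1 / 12 * real n))"
      by (simp add: exp_add [symmetric])
    also have "\<dots> \<le> exp (- (2 * (u * real n)))"
    proof -
      have "e \<le> 1" by (simp add: e_def power_le_one)
      then have "2 * u \<le> 1 / 12" using eu by simp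
      then have "(2 * u) * real n \<le> (1 / 12) * real n" by (intro mult_right_mono) auto
      then show ?thesis by simp
    qed
    finally show ?thesis .
  next
    case large
    \<comment> \<open>Since \<open>e \<le> 0.82\<close> and \<open>(1 - y) ^ k \<le> 0.45 e\<close>, the loss \<open>(1 + e) (1 - y) ^ k\<close> is less than
      \<open>0.82 e\<close>, so that \<open>0.18 e\<close> of the excess \<open>e\<close> remains.\<close>
    define c where "c = 1 + 0.18 * e"
    have e_le: "e \<le> 0.82"
    proof -
      have "e \<le> 0.99 ^ 20"
        unfolding e_def using k by (intro power_decreasing) auto
      then show ?thesis by (simp add: power_divide)
    qed
    have "(1 - y) ^ k \<le> 0.95 ^ k"
      using large y by (intro power_mono) auto
    also have "(0.95 :: real) ^ k = (95 / 99) ^ k * e"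
      unfolding e_def power_mult_distrib [symmetric] by simp
    also have "\<dots> \<le> 0.45 * e"
    proof (rule mult_right_mono)
      have "(95 / 99 :: real) ^ k \<le> (95 / 99) ^ 20"
        using k by (intro power_decreasing) auto
      then show "(95 / 99 :: real) ^ k \<le> 0.45" by (simp add: power_divide)
    qed (use e in simp)
    finally have pow: "(1 - y) ^ k \<le> 0.45 * e" .
    have "e * e \<le> 82 / 100 * e" using e e_le by (intro mult_right_mono) auto
    then have "1 + 18 / 100 * e \<le> 1 + e - 45 / 100 * e - 45 / 100 * (e * e)"
      using e by linarith
    also have "\<dots> = (1 + e) * (1 - 45 / 100 * e)"
      by (simp add: field_simps)
    finally have "c \<le> (1 + e) * (1 - 45 / 100 * e)"
      by (simp add: c_def)
    also have "\<dots> \<le> (1 + e) * (1 - (1 - y) ^ k)"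
      using pow e by (intro mult_left_mono) auto
    finally have "pair_weight k n d \<le> exp (- (real n * c * ln 2))"
      by (intro pair_weight_le) (simp add: e_def y_def)
    moreover have "real (n choose d) \<le> exp (real n * ln 2)"
    proof -
      have "real (n choose d) \<le> real (2 ^ n)"
        by (subst of_nat_le_iff) (rule binomial_le_pow2)
      then show ?thesis by (simp add: exp_of_nat_mult)
    qed
    ultimately have "real (n choose d) * pair_weight k n d
        \<le> exp (real n * ln 2) * exp (- (real n * c * ln 2))"
      by (intro mult_mono) (auto simp: pair_weight_def)
    also have "\<dots> = exp (- (0.18 * e * real n * ln 2))"
      by (simp add: exp_add [symmetric] c_def algebra_simps)
    also have "\<dots> \<le> exp (- (2 * (u * real n)))"
    proof -
      have "0.18 * e * real n * (2 / 3) \<le> 0.18 * e * real n * ln 2"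
        using ln2 e by (intro mult_left_mono) auto
      moreover have "20000 * u * real n \<le> e * real n"
        using eu by (intro mult_right_mono) auto
      ultimately show ?thesis using un by simp
    qed
    finally show ?thesis .
  qed
  then show ?thesis by (simp add: u_def)
qed

text \<open>
  Further solutions close to a planted one are to be expected: at \<open>d\<close> about \<open>n / 2 ^ k\<close> the product
  \<open>(n choose d) * 2 ^ (- k d)\<close> has exponential order \<open>exp (n / 2 ^ k)\<close>. Below the threshold of
  \<open>binomial_times_weight_le_far\<close> the weight is indeed at most
  \<open>2 ^ (- k d)\<close>, because \<open>50 k ^ 2 / 2 ^ k \<le> 0.99 ^ k\<close>.
\<close>

lemma binomial_times_weight_le:
  assumes k: "k \<ge> 20" and n: "0 < n" and d: "d \<le> n"
  shows "real (n choose d) * pair_weight k n d \<le> exp (real n / 2 ^ k)"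
proof (cases "real d \<ge> 50 * real k / 2 ^ k * real n")
  case True
  have "real (n choose d) * pair_weight k n d \<le> exp (- (2 * real n / 2 ^ k))"
    by (rule binomial_times_weight_le_far) fact+
  also have "\<dots> \<le> exp (real n / 2 ^ k)"
    by (simp add: field_simps)
  finally show ?thesis .
next
  case False
  have "real k * real d \<le> real k * (50 * real k / 2 ^ k * real n)"
    using False by (intro mult_left_mono) auto
  also have "\<dots> = 50 * real k ^ 2 / 2 ^ k * real n"
    by (simp add: power2_eq_square)
  also have "\<dots> \<le> 0.99 ^ k * real n"
    by (intro mult_right_mono power_099_ge k) auto
  finally have "pair_weight k n d \<le> 1 / 2 ^ (k * d)"
    using n d by (intro pair_weight_le_close)
  then have "real (n choose d) * pair_weight k n d
      \<le> exp (real n * (1 / 2 ^ k)) / (1 / 2 ^ k) ^ d * (1 / 2 ^ (k * d))"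
    by (intro mult_mono binomial_le_exp_over_power) (auto simp: pair_weight_def)
  also have "\<dots> = exp (real n / 2 ^ k)"
    by (simp add: power_mult power_divide)
  finally show ?thesis .
qed

section \<open>Formulas satisfied by two assignments\<close>

lemma finite_k_clauses: "finite (k_clauses k n)"
  by (rule finite_subset [of _ "Pow ({..<n} \<times> UNIV)"]) (auto simp: k_clauses_def)

lemma finite_assignments: "finite (assignments n)"
  by (auto simp: assignments_def intro: finite_PiE)

lemma hamming_le: "hamming n \<sigma> \<tau> \<le> n"
proof -
  have "hamming n \<sigma> \<tau> \<le> card {..<n}"
    unfolding hamming_def by (intro card_mono) auto
  then show ?thesis by simp
qed

definition falsified :: "nat \<Rightarrow> nat \<Rightarrow> (nat \<Rightarrow> bool) \<Rightarrow> cnf" where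
  "falsified k n \<sigma> = {C \<in> k_clauses k n. \<forall>(x, b)\<in>C. \<sigma> x \<noteq> b}"

lemma falsified_subset: "falsified k n \<sigma> \<subseteq> k_clauses k n"
  by (auto simp: falsified_def)

lemma satisfies_iff_disjoint:
  "F \<subseteq> k_clauses k n \<Longrightarrow> satisfies \<sigma> F \<longleftrightarrow> F \<inter> falsified k n \<sigma> = {}"
  by (fastforce simp: satisfies_def falsified_def)

text \<open>
  A clause falsified by both assignments consists of the literals opposite to \<open>\<sigma>\<close> on a set of \<open>k\<close>
  variables on which \<open>\<sigma>\<close> and \<open>\<tau>\<close> agree.
\<close>

lemma card_falsified_Int:
  "card (falsified k n \<sigma> \<inter> falsified k n \<tau>) = (n - hamming n \<sigma> \<tau>) choose k"
proof -
  define D where "D = {x \<in> {..<n}. \<sigma> x = \<tau> x}"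
  define g where "g A = (\<lambda>x. (x, \<not> \<sigma> x)) ` A" for A
  have "bij_betw g {A. A \<subseteq> D \<and> card A = k} (falsified k n \<sigma> \<inter> falsified k n \<tau>)"
    unfolding bij_betw_def
  proof
    have "inj (\<lambda>x. (x, \<not> \<sigma> x))" by (auto intro: injI)
    then show "inj_on g {A. A \<subseteq> D \<and> card A = k}"
      unfolding g_def by (intro inj_onI) (simp only: inj_image_eq_iff)
    show "g ` {A. A \<subseteq> D \<and> card A = k} = falsified k n \<sigma> \<inter> falsified k n \<tau>"
    proof
      show "g ` {A. A \<subseteq> D \<and> card A = k} \<subseteq> falsified k n \<sigma> \<inter> falsified k n \<tau>"
        by (auto simp: g_def D_def falsified_def k_clauses_def card_image inj_on_def)
      show "falsified k n \<sigma> \<inter> falsified k n \<tau> \<subseteq> g ` {A. A \<subseteq> D \<and> card A = k}"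
      proof
        fix C assume C: "C \<in> falsified k n \<sigma> \<inter> falsified k n \<tau>"
        have "fst ` C \<subseteq> D"
          using C by (fastforce simp: D_def falsified_def k_clauses_def)
        moreover have "card (fst ` C) = k"
          using C by (auto simp: falsified_def k_clauses_def card_image)
        moreover have "g (fst ` C) = (\<lambda>l. l) ` C"
          unfolding g_def image_image
          by (rule image_cong) (use C in \<open>auto simp: falsified_def\<close>)
        ultimately show "C \<in> g ` {A. A \<subseteq> D \<and> card A = k}"
          by (intro image_eqI [of _ _ "fst ` C"]) auto
      qed
    qed
  qed
  then have "card (falsified k n \<sigma> \<inter> falsified k n \<tau>) = card D choose k"
    by (simp add: bij_betw_same_card [symmetric] n_subsets D_def)
  moreover have "card D = n - hamming n \<sigma> \<tau>"
  proof -
    have "D = {..<n} - {x \<in> {..<n}. \<sigma> x \<noteq> \<tau> x}" by (auto simp: D_def)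
    moreover have "finite {x \<in> {..<n}. \<sigma> x \<noteq> \<tau> x}" by simp
    ultimately show ?thesis
      unfolding hamming_def by (simp only: card_Diff_subset Collect_subset card_lessThan)
  qed
  ultimately show ?thesis by simp
qed

lemma card_falsified: "card (falsified k n \<sigma>) = n choose k"
  using card_falsified_Int [of k n \<sigma> \<sigma>] by (simp add: hamming_def)

lemma card_k_cnfs_avoiding:
  assumes "V \<subseteq> k_clauses k n"
  shows "card {F \<in> k_cnfs k n m. F \<inter> V = {}} = (card (k_clauses k n) - card V) choose m"
proof -
  have "{F \<in> k_cnfs k n m. F \<inter> V = {}} = {F. F \<subseteq> k_clauses k n - V \<and> card F = m}"
    by (auto simp: k_cnfs_def)
  then show ?thesis
    using assms finite_subset [OF assms finite_k_clauses] finite_k_clauses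
    by (simp add: n_subsets card_Diff_subset)
qed

lemma card_satisfied_by:
  "card {F \<in> k_cnfs k n m. satisfies \<sigma> F} = ((2 ^ k - 1) * (n choose k)) choose m"
proof -
  have "{F \<in> k_cnfs k n m. satisfies \<sigma> F} = {F \<in> k_cnfs k n m. F \<inter> falsified k n \<sigma> = {}}"
    by (auto simp: k_cnfs_def satisfies_iff_disjoint)
  then show ?thesis
    by (simp add: card_k_cnfs_avoiding falsified_subset card_falsified card_k_clauses
        diff_mult_distrib)
qed

text \<open>
  By inclusion--exclusion the two assignments exclude \<open>2 N - N'\<close> clauses, where \<open>N = n choose k\<close> and
  \<open>N' = (n - d) choose k\<close>, while one assignment excludes \<open>N\<close>. Requiring the second one as well thus
  shrinks the supply of clauses by the factor \<open>1 - (1 - N' / N) / (2 ^ k - 1)\<close>, and the number of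
  formulas by at least its \<open>m\<close>-th power.
\<close>

lemma card_satisfied_by_both_le:
  assumes k: "k \<ge> 1" and n: "0 < n" "0 < n choose k"
    and m: "real m \<ge> (1 + 0.99 ^ k) * 2 ^ k * ln 2 * real n"
  shows "real (card {F \<in> k_cnfs k n m. satisfies \<sigma> F \<and> satisfies \<tau> F})
    \<le> real (((2 ^ k - 1) * (n choose k)) choose m) * pair_weight k n (hamming n \<sigma> \<tau>)"
proof -
  define d where "d = hamming n \<sigma> \<tau>"
  define N where "N = n choose k"
  define V where "V = falsified k n \<sigma> \<union> falsified k n \<tau>"
  define a where "a = 2 ^ k * N - card V"
  define b where "b = (2 ^ k - 1) * N"
  define z where "z = 1 - (1 - real d / real n) ^ k"
  have d: "d \<le> n" by (simp add: d_def hamming_le)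
  then have z: "0 \<le> z"
    using n by (simp add: z_def power_le_one)
  have two: "(2 :: real) ^ k > 1" using k by simp
  have V: "V \<subseteq> k_clauses k n" by (simp add: V_def falsified_subset)
  have fin: "finite (falsified k n \<rho>)" for \<rho>
    using falsified_subset finite_k_clauses by (rule finite_subset)
  have "card V + ((n - d) choose k) = 2 * N"
    using card_Un_Int [OF fin fin, of \<sigma> \<tau>]
    by (simp add: V_def card_falsified card_falsified_Int d_def N_def)
  then have cV: "real (card V) = 2 * real N - real ((n - d) choose k)"
    by linarith
  have VN: "card V \<le> 2 ^ k * N"
    using card_mono [OF finite_k_clauses V] by (simp add: card_k_clauses N_def)
  have a: "real a = (2 ^ k - 2) * real N + real ((n - d) choose k)"
    using VN by (simp add: a_def of_nat_diff cV algebra_simps)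
  have b: "real b = (2 ^ k - 1) * real N"
    by (simp add: b_def of_nat_diff)
  have bpos: "0 < b"
  proof -
    have "0 < real b" using two n by (simp add: b N_def del: zero_less_binomial_iff)
    then show ?thesis by simp
  qed
  have smaller: "real ((n - d) choose k) \<le> real N * (1 - z)"
    using binomial_ratio_le [of "n - d" n k] n d
    by (simp add: N_def z_def of_nat_diff diff_divide_distrib)
  have "real N * z \<ge> 0" using z by simp
  have "real a \<le> (2 ^ k - 2) * real N + real N * (1 - z)"
    using a smaller by linarith
  also have "\<dots> = (2 ^ k - 1) * real N - real N * z"
    by (simp add: algebra_simps)
  finally have a_le: "real a \<le> (2 ^ k - 1) * real N - real N * z" .
  then have "real a \<le> real b"
    using b \<open>real N * z \<ge> 0\<close> by linarith
  then have ab: "a \<le> b" by simp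
  have "real a / real b \<le> 1 - z / 2 ^ k"
  proof -
    have "real a \<le> (2 ^ k - 1) * real N - real N * z" by (rule a_le)
    also have "\<dots> \<le> (2 ^ k - 1) * real N - (2 ^ k - 1) / 2 ^ k * (real N * z)"
      using z by (intro diff_left_mono mult_left_le_one_le) (auto simp: field_simps)
    also have "\<dots> = (1 - z / 2 ^ k) * real b"
      by (simp add: b field_simps)
    finally show ?thesis using bpos by (simp add: field_simps)
  qed
  also have "\<dots> \<le> exp (- (z / 2 ^ k))"
    using exp_ge_add_one_self [of "- (z / 2 ^ k)"] by simp
  finally have ratio: "real a / real b \<le> exp (- (z / 2 ^ k))" .
  have "{F \<in> k_cnfs k n m. satisfies \<sigma> F \<and> satisfies \<tau> F} = {F \<in> k_cnfs k n m. F \<inter> V = {}}"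
    by (auto simp: k_cnfs_def satisfies_iff_disjoint V_def)
  then have "real (card {F \<in> k_cnfs k n m. satisfies \<sigma> F \<and> satisfies \<tau> F}) = real (a choose m)"
    by (simp add: card_k_cnfs_avoiding V card_k_clauses a_def N_def)
  also have "\<dots> \<le> real (b choose m) * (real a / real b) ^ m"
    by (rule binomial_ratio_le [OF ab bpos])
  also have "\<dots> \<le> real (b choose m) * exp (- (z / 2 ^ k)) ^ m"
    by (intro mult_left_mono power_mono ratio) auto
  also have "\<dots> = real (b choose m) * exp (- (real m * (z / 2 ^ k)))"
    by (simp add: exp_of_nat_mult [symmetric])
  also have "\<dots> \<le> real (b choose m) * pair_weight k n d"
  proof -
    have "(1 + 0.99 ^ k) * 2 ^ k * ln 2 * real n * (z / 2 ^ k) \<le> real m * (z / 2 ^ k)"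
      using m z by (intro mult_right_mono) auto
    then have "exp (- (real m * (z / 2 ^ k))) \<le> pair_weight k n d"
      by (simp add: pair_weight_def z_def mult_ac)
    then show ?thesis by (intro mult_left_mono) auto
  qed
  finally show ?thesis by (simp add: b_def N_def d_def)
qed

lemma card_at_distance_le:
  assumes "\<sigma> \<in> assignments n"
  shows "card {\<tau> \<in> assignments n. hamming n \<sigma> \<tau> = d} \<le> n choose d"
proof -
  define g where "g \<tau> = {x \<in> {..<n}. \<sigma> x \<noteq> \<tau> x}" for \<tau>
  have "inj_on g {\<tau> \<in> assignments n. hamming n \<sigma> \<tau> = d}"
  proof (rule inj_onI)
    fix \<tau> \<rho> assume *: "\<tau> \<in> {\<tau> \<in> assignments n. hamming n \<sigma> \<tau> = d}"
      "\<rho> \<in> {\<tau> \<in> assignments n. hamming n \<sigma> \<tau> = d}" "g \<tau> = g \<rho>"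
    show "\<tau> = \<rho>"
    proof (rule PiE_ext)
      show "\<tau> \<in> {..<n} \<rightarrow>\<^sub>E UNIV" "\<rho> \<in> {..<n} \<rightarrow>\<^sub>E UNIV"
        using * by (auto simp: assignments_def)
      fix x assume "x \<in> {..<n}"
      then have "\<sigma> x \<noteq> \<tau> x \<longleftrightarrow> \<sigma> x \<noteq> \<rho> x"
        using *(3) by (auto simp: g_def set_eq_iff)
      then show "\<tau> x = \<rho> x" by auto
    qed
  qed
  then have "card {\<tau> \<in> assignments n. hamming n \<sigma> \<tau> = d} \<le> card {A. A \<subseteq> {..<n} \<and> card A = d}"
    by (rule card_inj_on_le) (auto simp: g_def hamming_def)
  then show ?thesis by (simp add: n_subsets)
qed

lemma sum_hamming_le:
  assumes "\<sigma> \<in> assignments n" and f: "\<And>d. 0 \<le> f d"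
    and bound: "\<And>d. d \<le> n \<Longrightarrow> Q d \<Longrightarrow> real (n choose d) * f d \<le> c" and "0 \<le> c"
  shows "(\<Sum>\<tau> | \<tau> \<in> assignments n \<and> Q (hamming n \<sigma> \<tau>). f (hamming n \<sigma> \<tau>)) \<le> (real n + 1) * c"
proof -
  let ?T = "{\<tau>. \<tau> \<in> assignments n \<and> Q (hamming n \<sigma> \<tau>)}"
  have "(\<Sum>\<tau>\<in>?T. f (hamming n \<sigma> \<tau>))
      = (\<Sum>d\<in>{..n}. \<Sum>\<tau>\<in>{\<tau> \<in> ?T. hamming n \<sigma> \<tau> = d}. f (hamming n \<sigma> \<tau>))"
    using finite_assignments hamming_le by (intro sum.group [symmetric]) auto
  also have "\<dots> \<le> (\<Sum>d\<in>{..n}. c)"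
  proof (rule sum_mono)
    fix d assume d: "d \<in> {..n}"
    show "(\<Sum>\<tau>\<in>{\<tau> \<in> ?T. hamming n \<sigma> \<tau> = d}. f (hamming n \<sigma> \<tau>)) \<le> c"
    proof (cases "Q d")
      case True
      then have "{\<tau> \<in> ?T. hamming n \<sigma> \<tau> = d} = {\<tau> \<in> assignments n. hamming n \<sigma> \<tau> = d}"
        by auto
      then have "(\<Sum>\<tau>\<in>{\<tau> \<in> ?T. hamming n \<sigma> \<tau> = d}. f (hamming n \<sigma> \<tau>))
          = real (card {\<tau> \<in> assignments n. hamming n \<sigma> \<tau> = d}) * f d"
        by simp
      also have "\<dots> \<le> real (n choose d) * f d"
        using card_at_distance_le [OF assms(1)] f by (intro mult_right_mono) auto
      also have "\<dots> \<le> c"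
        using bound d True by simp
      finally show ?thesis .
    next
      case False
      then have "{\<tau> \<in> ?T. hamming n \<sigma> \<tau> = d} = {}" by auto
      then show ?thesis using \<open>0 \<le> c\<close> by (simp only: sum.empty)
    qed
  qed
  also have "\<dots> = (real n + 1) * c"
    by (simp add: algebra_simps)
  finally show ?thesis .
qed

section \<open>The fraction of formulas with distant solutions\<close>

lemma r_max_gtD:
  assumes "satisfiable n F" "\<not> real (r_max n F) \<le> r"
  shows "\<exists>\<sigma>\<in>assignments n. \<exists>\<tau>\<in>assignments n.
    satisfies \<sigma> F \<and> satisfies \<tau> F \<and> real (hamming n \<sigma> \<tau>) > r"
proof -
  let ?D = "{hamming n \<sigma> \<tau> | \<sigma> \<tau>. \<sigma> \<in> solutions n F \<and> \<tau> \<in> solutions n F}"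
  have "finite ?D"
    by (rule finite_subset [of _ "{..n}"]) (auto simp: hamming_le)
  moreover have "?D \<noteq> {}"
    using assms(1) by (auto simp: satisfiable_def solutions_def)
  ultimately have "r_max n F \<in> ?D"
    unfolding r_max_def by (rule Max_in)
  then show ?thesis
    using assms(2) by (fastforce simp: solutions_def)
qed

text \<open>
  With \<open>A = (n + 1) exp (n / 2 ^ k)\<close> bounding the expected number of all solutions and
  \<open>B = (n + 1) exp (- 2 n / 2 ^ k)\<close> that of the far ones, the fraction is at most \<open>A * B\<close>.
\<close>

lemma bad_fraction_le:
  assumes k: "k \<ge> 20" and n: "0 < n"
    and m: "0 < m" "m \<le> (2 ^ k - 1) * (n choose k)"
      "real m / real n \<ge> (1 + 0.99 ^ k) * 2 ^ k * ln 2"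
  shows "real (card {F \<in> sat_k_cnfs k n m. \<not> real (r_max n F) \<le> 50 * real k / 2 ^ k * real n})
      / real (card (sat_k_cnfs k n m))
    \<le> (real n + 1)\<^sup>2 * exp (- (real n * (1 / 2 ^ k)))"
proof -
  define c where "c = real (((2 ^ k - 1) * (n choose k)) choose m)"
  define r where "r = 50 * real k / 2 ^ k * real n"
  define A where "A = (real n + 1) * exp (real n / 2 ^ k)"
  define B where "B = (real n + 1) * exp (- (2 * real n / 2 ^ k))"
  let ?bad = "{F \<in> sat_k_cnfs k n m. \<not> real (r_max n F) \<le> r}"
  have fin: "finite (k_cnfs k n m)"
    by (rule finite_subset [of _ "Pow (k_clauses k n)"]) (auto simp: k_cnfs_def finite_k_clauses)
  have pos: "0 < n choose k" using m by (cases "n choose k = 0") auto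
  have m': "real m \<ge> (1 + 0.99 ^ k) * 2 ^ k * ln 2 * real n"
    using m(3) n by (simp add: field_simps)
  have both: "real (card {F \<in> k_cnfs k n m. satisfies \<sigma> F \<and> satisfies \<tau> F})
      \<le> c * pair_weight k n (hamming n \<sigma> \<tau>)" for \<sigma> \<tau>
    unfolding c_def using k n pos m' by (intro card_satisfied_by_both_le) auto
  have sum: "(\<Sum>\<tau>\<in>{\<tau> \<in> assignments n. Q (hamming n \<sigma> \<tau>)}.
        real (card {F \<in> k_cnfs k n m. satisfies \<sigma> F \<and> satisfies \<tau> F}))
      \<le> c * ((real n + 1) * w)"
    if "\<sigma> \<in> assignments n" "0 \<le> w"
      "\<And>d. d \<le> n \<Longrightarrow> Q d \<Longrightarrow> real (n choose d) * pair_weight k n d \<le> w" for \<sigma> Q w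
  proof -
    have "(\<Sum>\<tau>\<in>{\<tau> \<in> assignments n. Q (hamming n \<sigma> \<tau>)}.
          real (card {F \<in> k_cnfs k n m. satisfies \<sigma> F \<and> satisfies \<tau> F}))
        \<le> (\<Sum>\<tau>\<in>{\<tau> \<in> assignments n. Q (hamming n \<sigma> \<tau>)}. c * pair_weight k n (hamming n \<sigma> \<tau>))"
      by (intro sum_mono both)
    also have "\<dots> \<le> c * ((real n + 1) * w)"
      unfolding sum_distrib_left [symmetric] using that
      by (intro mult_left_mono sum_hamming_le) (auto simp: c_def pair_weight_def)
    finally show ?thesis .
  qed
  have "?bad \<subseteq> {F \<in> k_cnfs k n m. \<exists>\<sigma>\<in>assignments n. \<exists>\<tau>\<in>assignments n.
      satisfies \<sigma> F \<and> satisfies \<tau> F \<and> r < real (hamming n \<sigma> \<tau>)}"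
    using r_max_gtD by (auto simp: sat_k_cnfs_def)
  then have "real (card ?bad) \<le> real (card {F \<in> k_cnfs k n m. \<exists>\<sigma>\<in>assignments n. \<exists>\<tau>\<in>assignments n.
      satisfies \<sigma> F \<and> satisfies \<tau> F \<and> r < real (hamming n \<sigma> \<tau>)})"
    using fin by (intro of_nat_mono card_mono) auto
  also have "\<dots> \<le> A * B * real (card {F \<in> k_cnfs k n m. \<exists>\<sigma>\<in>assignments n. satisfies \<sigma> F})"
  proof (rule second_moment_bound [where c = c and R = "\<lambda>F \<sigma>. satisfies \<sigma> F"])
    show "0 < c" using m by (simp add: c_def)
    show "real (card {F \<in> k_cnfs k n m. satisfies \<sigma> F}) = c" for \<sigma>
      by (simp add: card_satisfied_by c_def)
    fix \<sigma> assume \<sigma>: "\<sigma> \<in> assignments n"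
    show "(\<Sum>\<tau>\<in>assignments n. real (card {F \<in> k_cnfs k n m. satisfies \<sigma> F \<and> satisfies \<tau> F})) \<le> c * A"
      using sum [OF \<sigma>, of "exp (real n / 2 ^ k)" "\<lambda>_. True"] binomial_times_weight_le [OF k n]
      by (simp add: A_def)
    show "(\<Sum>\<tau>\<in>{\<tau> \<in> assignments n. r < real (hamming n \<sigma> \<tau>)}.
        real (card {F \<in> k_cnfs k n m. satisfies \<sigma> F \<and> satisfies \<tau> F})) \<le> c * B"
      unfolding B_def
    proof (rule sum [OF \<sigma>])
      show "real (n choose d) * pair_weight k n d \<le> exp (- (2 * real n / 2 ^ k))"
        if "d \<le> n" "r < real d" for d
        using that by (intro binomial_times_weight_le_far k n) (simp_all add: r_def)
    qed simp
  qed (auto simp: fin finite_assignments A_def B_def)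
  also have "{F \<in> k_cnfs k n m. \<exists>\<sigma>\<in>assignments n. satisfies \<sigma> F} = sat_k_cnfs k n m"
    by (simp add: sat_k_cnfs_def satisfiable_def)
  finally have "real (card ?bad) / real (card (sat_k_cnfs k n m)) \<le> A * B"
    by (cases "card (sat_k_cnfs k n m) = 0") (auto simp: A_def B_def divide_le_eq)
  also have "A * B = (real n + 1)\<^sup>2 * (exp (real n / 2 ^ k) * exp (- (2 * real n / 2 ^ k)))"
    by (simp add: A_def B_def power2_eq_square)
  also have "exp (real n / 2 ^ k) * exp (- (2 * real n / 2 ^ k)) = exp (- (real n * (1 / 2 ^ k)))"
    by (simp flip: exp_add)
  finally show ?thesis by (simp add: r_def)
qed

theorem theorem1:
  fixes k :: nat and m :: "nat \<Rightarrow> nat"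
  assumes "k \<ge> 20"
    and "\<forall>\<^sub>F n in sequentially. 0 < m n \<and> m n \<le> (2 ^ k - 1) * (n choose k)
           \<and> real (m n) / real n \<ge> (1 + 0.99 ^ k) * 2 ^ k * ln 2"
  shows "(\<lambda>n. real (card {F \<in> sat_k_cnfs k n (m n).
                        \<not> real (r_max n F) \<le> 50 * real k / 2 ^ k * real n})
              / real (card (sat_k_cnfs k n (m n)))) \<longlonglongrightarrow> 0"
proof (rule tendsto_sandwich [OF _ _ tendsto_const])
  show "(\<lambda>n. (real n + 1)\<^sup>2 * exp (- (real n * (1 / 2 ^ k)))) \<longlonglongrightarrow> 0"
  proof -
    have *: "(\<lambda>n. (real n + 1)\<^sup>2 * exp (- (real n * u))) \<longlonglongrightarrow> 0" if "u > 0" for u :: real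
      using that by real_asymp
    show ?thesis by (rule *) simp
  qed
  show "\<forall>\<^sub>F n in sequentially. real (card {F \<in> sat_k_cnfs k n (m n).
        \<not> real (r_max n F) \<le> 50 * real k / 2 ^ k * real n}) / real (card (sat_k_cnfs k n (m n)))
      \<le> (real n + 1)\<^sup>2 * exp (- (real n * (1 / 2 ^ k)))"
    using assms(2) eventually_gt_at_top [of 0]
    by eventually_elim (use assms(1) in \<open>intro bad_fraction_le, auto\<close>)
qed simp
end
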